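(* Let $G=(V,E)$ be a finite connected simple graph with $E\ne\varnothing$. The universal upper bound $$\kappa_{\max}^{\mathrm{LLY}}(G)\le 1+\frac{1}{\operatorname{mad}(G)}$$ is attained by a positive weight (i.e. there is $w:E\to(0,\infty)$ with $\kappa_{\mathrm{LLY}}^w(G)=1+\frac1{\operatorname{mad}(G)}$) if and only if $G$ is complete. In particular, for $G=K_n$ (with $n\ge2$), $$\kappa_{\max}^{\mathrm{LLY}}(K_n)=\frac{n}{n-1},$$ and every maximizing weight is constant up to global scaling (i.e. assigns the same value to all edges).
   Context: Graphs are finite, simple and undirected. $K_n$ is the complete graph on $n$ vertices. The maximum average degree is $\operatorname{mad}(G):=\max_{\varnothing\ne H\subseteq G}\frac{2|E(H)|}{|V(H)|}$, the maximum being over nonempty subgraphs $H$ of $G$. Lin--Lu--Yau curvature with fixed combinatorial distance: let $G=(V,E)$ be finite and connected with $E\neq\varnothing$, and let $d$ be its combinatorial (shortest-path) distance. A positive edge weight is a function $w:E\to(0,\infty)$; put $d_x^w:=\sum_{z\sim x}w_{xz}$. For $\alpha\in[0,1]$ and $x\in V$ let $\mu_x^{\alpha,w}$ be the probability measure on $V$ with $\mu_x^{\alpha,w}(x)=\alpha$, $\mu_x^{\alpha,w}(z)=(1-\alpha)w_{xz}/d_x^w$ if $z\sim x$, and $\mu_x^{\alpha,w}(z)=0$ otherwise. Let $W_1$ be the $1$-Wasserstein distance with respect to $d$ (independent of $w$). For an edge $e=xy$, put $\kappa_\alpha^w(x,y):=1-W_1(\mu_x^{\alpha,w},\mu_y^{\alpha,w})$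 and $$\kappa_{\mathrm{LLY}}^w(e)=\kappa_{\mathrm{LLY}}^w(x,y):=\lim_{\alpha\to1^-}\frac{\kappa_\alpha^w(x,y)}{1-\alpha}.$$ Put $\kappa_{\mathrm{LLY}}^w(G):=\min_{e\in E}\kappa_{\mathrm{LLY}}^w(e)$ and $\kappa_{\max}^{\mathrm{LLY}}(G):=\sup_{w:E\to(0,\infty)}\kappa_{\mathrm{LLY}}^w(G)$. A maximizing weight is a positive edge weight $w$ with $\kappa_{\mathrm{LLY}}^w(G)=\kappa_{\max}^{\mathrm{LLY}}(G)$. *)

theory Defs
  imports Complex_Main
begin

text \<open>
  A graph is given by its vertex set \<open>V\<close> and its set \<open>E\<close> of two-element edges.
\<close>

definition simple_graph :: "'a set \<Rightarrow> 'a set set \<Rightarrow> bool" where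
  "simple_graph V E \<longleftrightarrow> finite V \<and> (\<forall>e\<in>E. e \<subseteq> V \<and> card e = 2)"

definition adj_rel :: "'a set set \<Rightarrow> ('a \<times> 'a) set" where
  "adj_rel E = {(x, y). {x, y} \<in> E}"

definition graph_connected :: "'a set \<Rightarrow> 'a set set \<Rightarrow> bool" where
  "graph_connected V E \<longleftrightarrow> V \<noteq> {} \<and> (\<forall>x\<in>V. \<forall>y\<in>V. (x, y) \<in> (adj_rel E)\<^sup>*)"

definition graph_complete :: "'a set \<Rightarrow> 'a set set \<Rightarrow> bool" where
  "graph_complete V E \<longleftrightarrow> (\<forall>x\<in>V. \<forall>y\<in>V. x \<noteq> y \<longrightarrow> {x, y} \<in> E)"

definition subgraph_of :: "'a set \<Rightarrow> 'a set set \<Rightarrow> 'a set \<Rightarrow> 'a set set \<Rightarrow> bool" where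
  "subgraph_of W F V E \<longleftrightarrow> simple_graph W F \<and> W \<subseteq> V \<and> F \<subseteq> E"

definition mad :: "'a set \<Rightarrow> 'a set set \<Rightarrow> real" where
  "mad V E =
     Max {2 * real (card F) / real (card W) | W F. subgraph_of W F V E \<and> W \<noteq> {}}"

text \<open>
  A pair is in the \<open>n\<close>-th power of the adjacency relation iff its components are joined by
  a walk of length \<open>n\<close>. The value is only meaningful when \<open>x\<close> and \<open>y\<close> lie
  in the same component.
\<close>

definition gdist :: "'a set set \<Rightarrow> 'a \<Rightarrow> 'a \<Rightarrow> nat" where
  "gdist E x y = (LEAST n. (x, y) \<in> adj_rel E ^^ n)"

text \<open>
  Edge weights are total functions on sets of vertices; only their values on \<open>E\<close> are
  ever used.
\<close>

definition positive_weight :: "'a set set \<Rightarrow> ('a set \<Rightarrow> real) \<Rightarrow> bool" where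
  "positive_weight E w \<longleftrightarrow> (\<forall>e\<in>E. 0 < w e)"

definition wdeg :: "'a set set \<Rightarrow> ('a set \<Rightarrow> real) \<Rightarrow> 'a \<Rightarrow> real" where
  "wdeg E w x = (\<Sum>z | {x, z} \<in> E. w {x, z})"

text \<open>Probability measures on the finite set \<open>V\<close> are represented by their mass functions.\<close>

definition walk_measure :: "'a set set \<Rightarrow> ('a set \<Rightarrow> real) \<Rightarrow> real \<Rightarrow> 'a \<Rightarrow> 'a \<Rightarrow> real" where
  "walk_measure E w \<alpha> x z =
     (if z = x then \<alpha>
      else if {x, z} \<in> E then (1 - \<alpha>) * w {x, z} / wdeg E w x
      else 0)"

definition coupling :: "'a set \<Rightarrow> ('a \<Rightarrow> real) \<Rightarrow> ('a \<Rightarrow> real) \<Rightarrow> ('a \<Rightarrow> 'a \<Rightarrow> real) \<Rightarrow> bool" where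
  "coupling V \<mu> \<nu> \<pi> \<longleftrightarrow>
     (\<forall>a\<in>V. \<forall>b\<in>V. 0 \<le> \<pi> a b) \<and>
     (\<forall>a\<in>V. (\<Sum>b\<in>V. \<pi> a b) = \<mu> a) \<and>
     (\<forall>b\<in>V. (\<Sum>a\<in>V. \<pi> a b) = \<nu> b)"

definition wasserstein1 ::
    "'a set \<Rightarrow> ('a \<Rightarrow> 'a \<Rightarrow> real) \<Rightarrow> ('a \<Rightarrow> real) \<Rightarrow> ('a \<Rightarrow> real) \<Rightarrow> real" where
  "wasserstein1 V d \<mu> \<nu> = Inf {\<Sum>a\<in>V. \<Sum>b\<in>V. d a b * \<pi> a b | \<pi>. coupling V \<mu> \<nu> \<pi>}"

definition curv_alpha ::
    "'a set \<Rightarrow> 'a set set \<Rightarrow> ('a set \<Rightarrow> real) \<Rightarrow> real \<Rightarrow> 'a \<Rightarrow> 'a \<Rightarrow> real" where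
  "curv_alpha V E w \<alpha> x y =
     1 - wasserstein1 V (\<lambda>a b. real (gdist E a b)) (walk_measure E w \<alpha> x) (walk_measure E w \<alpha> y)"

definition lly_edge :: "'a set \<Rightarrow> 'a set set \<Rightarrow> ('a set \<Rightarrow> real) \<Rightarrow> 'a \<Rightarrow> 'a \<Rightarrow> real" where
  "lly_edge V E w x y = Lim (at_left 1) (\<lambda>\<alpha>. curv_alpha V E w \<alpha> x y / (1 - \<alpha>))"

definition lly_graph :: "'a set \<Rightarrow> 'a set set \<Rightarrow> ('a set \<Rightarrow> real) \<Rightarrow> real" where
  "lly_graph V E w = Min {lly_edge V E w x y | x y. {x, y} \<in> E}"

definition lly_max :: "'a set \<Rightarrow> 'a set set \<Rightarrow> real" where
  "lly_max V E = Sup {lly_graph V E w | w. positive_weight E w}"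

definition maximizing_weight :: "'a set \<Rightarrow> 'a set set \<Rightarrow> ('a set \<Rightarrow> real) \<Rightarrow> bool" where
  "maximizing_weight V E w \<longleftrightarrow> positive_weight E w \<and> lly_graph V E w = lly_max V E"

end

theory Submission
  imports Defs
begin

text \<open>
  Write \<open>p x z\<close> for the transition probabilities of the walk given by \<open>w\<close>. Two facts about
  transport drive the proof.

  The potential that is \<open>1\<close> at \<open>x\<close>, \<open>-1\<close> at every non-neighbour of \<open>x\<close> and \<open>0\<close> at the
  neighbours is 1-Lipschitz along edges. Testing the walks from the ends of an edge \<open>xy\<close> with
  it bounds the curvature by \<open>1 + p y x\<close> minus the probability of stepping from \<open>y\<close> to a
  non-neighbour of \<open>x\<close> (\<open>lly_edge_le\<close>). Moreover \<open>\<kappa>\<^sub>\<alpha> / (1 - \<alpha>)\<close> increases with \<open>\<alpha>\<close>,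
  because a lazier walk is a mixture of the given one with a point mass. So the limit
  defining the curvature exists and is a supremum (\<open>lly_edge_eq_Sup\<close>), which any single \<open>\<alpha>\<close>
  bounds from below.

  If all curvatures are at least \<open>1 + 1/mad\<close>, then all \<open>p x y\<close> on edges are at least
  \<open>1/mad\<close>. Summing over the ordered edges of a densest subgraph \<open>(W, F)\<close> gives at least
  \<open>2 card F / mad = card W\<close>, while the rows of \<open>p\<close> sum to \<open>1\<close>, so the total is at most
  \<open>card W\<close>. Hence equality holds everywhere: \<open>p = 1/mad\<close> on \<open>F\<close> and no edge leaves
  \<open>(W, F)\<close>, so that by connectedness \<open>p = 1/mad\<close> on every edge (\<open>step_prob_rigid\<close>). In
  particular no curvature minimum exceeds \<open>1 + 1/mad\<close>. When the minimum equals this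
  bound, \<open>w {x, y}\<close> is the weighted degree of \<open>x\<close>, and also that of \<open>y\<close>, divided by \<open>mad\<close>,
  so \<open>w\<close> is constant. An induced path \<open>x, y, z\<close> would then give the edge \<open>xy\<close> curvature at
  most \<open>1 + p y x - p y z = 1\<close>, which is too small, so the graph is complete.

  Conversely, on the complete graph with \<open>n\<close> vertices and constant weight, the walk of
  idleness \<open>\<alpha> = 1/n\<close> is uniform from every starting point. Hence \<open>\<kappa>\<^sub>\<alpha> = 1\<close> and the curvature
  is at least \<open>1 / (1 - 1/n) = n / (n - 1)\<close>, which meets the upper bound.
\<close>

section \<open>Connected graphs\<close>

locale conn_graph =
  fixes V :: "'a set" and E :: "'a set set"
  assumes simple: "simple_graph V E"
    and connected: "graph_connected V E"
    and nonempty: "E \<noteq> {}"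
begin

lemma finite_V: "finite V"
  using simple by (simp add: simple_graph_def)

lemma finite_E: "finite E"
proof (rule finite_subset)
  show "E \<subseteq> Pow V" using simple by (auto simp: simple_graph_def)
qed (simp add: finite_V)

lemma edgeD:
  assumes "{x, y} \<in> E"
  shows "x \<in> V" "y \<in> V" "x \<noteq> y" "{y, x} \<in> E"
  using assms simple by (auto simp: simple_graph_def insert_commute)

lemma no_loop [simp]: "{x, x} \<notin> E" "{x} \<notin> E"
  using edgeD(3)[of x x] by auto

lemma edge_pairE:
  assumes "e \<in> E"
  obtains x y where "e = {x, y}"
proof -
  have "card e = 2" using assms simple by (auto simp: simple_graph_def)
  then show thesis using that by (auto simp: card_2_iff)
qed

lemma some_edge: obtains x y where "{x, y} \<in> E"
  using nonempty edge_pairE by (metis all_not_in_conv)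

lemma connected_induct:
  assumes "x \<in> V" "y \<in> V" "P x" and step: "\<And>a b. P a \<Longrightarrow> {a, b} \<in> E \<Longrightarrow> P b"
  shows "P y"
proof -
  have "(x, y) \<in> (adj_rel E)\<^sup>*"
    using connected assms(1,2) by (auto simp: graph_connected_def)
  then show ?thesis
    by (induction rule: rtrancl_induct) (use assms(3) step in \<open>auto simp: adj_rel_def\<close>)
qed

lemma no_isolated_vertex:
  assumes "x \<in> V"
  obtains y where "{x, y} \<in> E"
proof -
  obtain a b where ab: "{a, b} \<in> E" by (rule some_edge)
  have "\<exists>y. {x, y} \<in> E"
    by (rule connected_induct[of a]) (use ab edgeD assms in \<open>auto dest: edgeD(4)\<close>)
  then show thesis using that by blast
qed

lemma card_V_pos: "card V > 0"
  using finite_V connected by (auto simp: graph_connected_def card_gt_0_iff)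

text \<open>A connected graph in which any two neighbours of a vertex are adjacent is complete, since
  being equal or adjacent to a fixed vertex then propagates along edges.\<close>

lemma induced_path_if_not_complete:
  assumes "\<not> graph_complete V E"
  obtains (path) x y z where "{x, y} \<in> E" "{y, z} \<in> E" "x \<noteq> z" "{x, z} \<notin> E"
proof (rule ccontr)
  assume "\<not> thesis"
  then have tr: "x = z \<or> {x, z} \<in> E" if "{x, y} \<in> E" "{y, z} \<in> E" for x y z
    using path[of x y z] that by blast
  have "x = y \<or> {x, y} \<in> E" if "x \<in> V" "y \<in> V" for x y
    by (rule connected_induct[of x]) (use that tr in auto)
  then show False using assms by (auto simp: graph_complete_def)
qed

section \<open>Maximum average degree\<close>

lemma finite_density_set:
  "finite {2 * real (card F) / real (card W) | W F. subgraph_of W F V E \<and> W \<noteq> {}}"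
proof (rule finite_subset)
  show "{2 * real (card F) / real (card W) | W F. subgraph_of W F V E \<and> W \<noteq> {}}
    \<subseteq> (\<lambda>(W, F). 2 * real (card F) / real (card W)) ` (Pow V \<times> Pow E)"
    by (auto simp: subgraph_of_def)
qed (use finite_V finite_E in auto)

lemma subgraph_self: "subgraph_of V E V E" "V \<noteq> {}"
  using simple connected by (auto simp: subgraph_of_def graph_connected_def)

lemma average_degree_le_mad: "2 * real (card E) / real (card V) \<le> mad V E"
  unfolding mad_def by (rule Max_ge[OF finite_density_set]) (use subgraph_self in blast)

lemma mad_pos: "mad V E > 0"
proof -
  have "0 < 2 * real (card E) / real (card V)"
    using finite_E nonempty card_V_pos by (auto simp: card_gt_0_iff)
  then show ?thesis using average_degree_le_mad by linarith
qed

lemma mad_attained: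
  obtains W F where "subgraph_of W F V E" "W \<noteq> {}" "mad V E * real (card W) = 2 * real (card F)"
proof -
  have "mad V E \<in> {2 * real (card F) / real (card W) | W F. subgraph_of W F V E \<and> W \<noteq> {}}"
    unfolding mad_def by (rule Max_in[OF finite_density_set]) (use subgraph_self in blast)
  then obtain W F where WF: "subgraph_of W F V E" "W \<noteq> {}"
      "mad V E = 2 * real (card F) / real (card W)"
    by blast
  have "finite W" using WF(1) by (simp add: subgraph_of_def simple_graph_def)
  then have "real (card W) > 0" using WF(2) by (simp add: card_gt_0_iff)
  then show thesis using that WF by auto
qed

end

text \<open>Each edge is counted once from each of its two ends.\<close>

lemma handshake:
  assumes "simple_graph W F"
  shows "(\<Sum>a\<in>W. card {b\<in>W. {a, b} \<in> F}) = 2 * card F"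
proof -
  let ?ends = "\<lambda>e. {(a, b). {a, b} = e}"
  have fin: "finite W" and F: "\<And>e. e \<in> F \<Longrightarrow> e \<subseteq> W \<and> card e = 2"
    using assms by (auto simp: simple_graph_def)
  have "finite F" by (rule finite_subset[of _ "Pow W"]) (use F fin in auto)
  have two: "finite (?ends e) \<and> card (?ends e) = 2" if "e \<in> F" for e
  proof -
    have "card e = 2" using F that by blast
    then obtain a b where ab: "e = {a, b}" "a \<noteq> b" by (auto simp: card_2_iff)
    then have "?ends e = {(a, b), (b, a)}" by (auto simp: doubleton_eq_iff)
    then show ?thesis using ab by simp
  qed
  have "(\<Sum>a\<in>W. card {b\<in>W. {a, b} \<in> F}) = card (SIGMA a:W. {b\<in>W. {a, b} \<in> F})"
    using fin by simp
  also have "(SIGMA a:W. {b\<in>W. {a, b} \<in> F}) = (\<Union>e\<in>F. ?ends e)"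
    using F by auto
  also have "card \<dots> = (\<Sum>e\<in>F. card (?ends e))"
    by (rule card_UN_disjoint) (use \<open>finite F\<close> two in auto)
  also have "\<dots> = 2 * card F" using two by simp
  finally show ?thesis .
qed

section \<open>The Wasserstein distance\<close>

lemma wasserstein1_le_cost:
  assumes "coupling V \<mu> \<nu> \<pi>" and "\<And>a b. 0 \<le> d a b"
  shows "wasserstein1 V d \<mu> \<nu> \<le> (\<Sum>a\<in>V. \<Sum>b\<in>V. d a b * \<pi> a b)"
  unfolding wasserstein1_def
proof (rule cInf_lower)
  show "bdd_below {\<Sum>a\<in>V. \<Sum>b\<in>V. d a b * \<pi> a b |\<pi>. coupling V \<mu> \<nu> \<pi>}"
    by (rule bdd_belowI[of _ 0]) (use assms(2) in \<open>auto simp: coupling_def intro!: sum_nonneg\<close>)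
qed (use assms(1) in blast)

lemma product_coupling:
  assumes "\<And>a. a \<in> V \<Longrightarrow> 0 \<le> \<mu> a" "\<And>a. a \<in> V \<Longrightarrow> 0 \<le> \<nu> a"
    and "sum \<mu> V = 1" "sum \<nu> V = 1"
  shows "coupling V \<mu> \<nu> (\<lambda>a b. \<mu> a * \<nu> b)"
  using assms by (auto simp: coupling_def simp flip: sum_distrib_left sum_distrib_right)

text \<open>The easy half of Kantorovich duality: a potential that is 1-Lipschitz for \<open>d\<close> pays at most
  \<open>d\<close> for each unit of transported mass.\<close>

lemma wasserstein1_ge_potential:
  assumes lip: "\<And>a b. a \<in> V \<Longrightarrow> b \<in> V \<Longrightarrow> g a - g b \<le> d a b"
    and ex: "coupling V \<mu> \<nu> \<pi>0"
  shows "(\<Sum>a\<in>V. g a * \<mu> a) - (\<Sum>a\<in>V. g a * \<nu> a) \<le> wasserstein1 V d \<mu> \<nu>"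
  unfolding wasserstein1_def
proof (rule cInf_greatest)
  show "{\<Sum>a\<in>V. \<Sum>b\<in>V. d a b * \<pi> a b |\<pi>. coupling V \<mu> \<nu> \<pi>} \<noteq> {}" using ex by blast
next
  fix c assume "c \<in> {\<Sum>a\<in>V. \<Sum>b\<in>V. d a b * \<pi> a b |\<pi>. coupling V \<mu> \<nu> \<pi>}"
  then obtain \<pi> where c: "c = (\<Sum>a\<in>V. \<Sum>b\<in>V. d a b * \<pi> a b)" and \<pi>: "coupling V \<mu> \<nu> \<pi>"
    by blast
  have "(\<Sum>a\<in>V. g a * \<mu> a) = (\<Sum>a\<in>V. \<Sum>b\<in>V. g a * \<pi> a b)"
    using \<pi> by (simp add: coupling_def flip: sum_distrib_left)
  moreover have "(\<Sum>b\<in>V. g b * \<nu> b) = (\<Sum>a\<in>V. \<Sum>b\<in>V. g b * \<pi> a b)"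
    by (subst sum.swap) (use \<pi> in \<open>simp add: coupling_def flip: sum_distrib_left\<close>)
  ultimately have "(\<Sum>a\<in>V. g a * \<mu> a) - (\<Sum>b\<in>V. g b * \<nu> b)
      = (\<Sum>a\<in>V. \<Sum>b\<in>V. (g a - g b) * \<pi> a b)"
    by (simp add: sum_subtractf algebra_simps)
  also have "\<dots> \<le> c"
    unfolding c by (intro sum_mono mult_right_mono lip) (use \<pi> in \<open>auto simp: coupling_def\<close>)
  finally show "(\<Sum>a\<in>V. g a * \<mu> a) - (\<Sum>b\<in>V. g b * \<nu> b) \<le> c" .
qed

text \<open>Transport the two parts of a mixture separately: the second part is moved from \<open>x\<close> to
  \<open>y\<close> at price \<open>d x y\<close>.\<close>

lemma wasserstein1_mix_point_masses:
  assumes fin: "finite V" and xy: "x \<in> V" "y \<in> V" and t: "0 < t" "t \<le> 1"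
    and d: "\<And>a b. 0 \<le> d a b" and ex: "coupling V \<mu> \<nu> \<pi>0"
    and \<mu>': "\<And>a. a \<in> V \<Longrightarrow> \<mu>' a = t * \<mu> a + (1 - t) * (if a = x then 1 else 0)"
    and \<nu>': "\<And>a. a \<in> V \<Longrightarrow> \<nu>' a = t * \<nu> a + (1 - t) * (if a = y then 1 else 0)"
  shows "wasserstein1 V d \<mu>' \<nu>' \<le> t * wasserstein1 V d \<mu> \<nu> + (1 - t) * d x y"
proof -
  let ?C = "{\<Sum>a\<in>V. \<Sum>b\<in>V. d a b * \<pi> a b |\<pi>. coupling V \<mu> \<nu> \<pi>}"
  let ?p = "\<lambda>a b. if a = x then if b = y then 1 else 0 else (0::real)"
  have rows: "(\<Sum>b\<in>V. ?p a b) = (if a = x then 1 else 0)" for a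
    using xy fin by simp
  have cols: "(\<Sum>a\<in>V. ?p a b) = (if b = y then 1 else 0)" for b
    using xy fin by simp
  have cost: "(\<Sum>a\<in>V. \<Sum>b\<in>V. d a b * ?p a b) = d x y"
  proof -
    have "(\<Sum>b\<in>V. d a b * ?p a b) = (if a = x then d x y else 0)" for a
      using xy fin by (simp add: if_distrib[of "(*) _"] cong: if_cong)
    then show ?thesis using xy fin by simp
  qed
  have "(wasserstein1 V d \<mu>' \<nu>' - (1 - t) * d x y) / t \<le> Inf ?C"
  proof (rule cInf_greatest)
    show "?C \<noteq> {}" using ex by blast
  next
    fix c assume "c \<in> ?C"
    then obtain \<pi> where c: "c = (\<Sum>a\<in>V. \<Sum>b\<in>V. d a b * \<pi> a b)" and \<pi>: "coupling V \<mu> \<nu> \<pi>"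
      by blast
    have "coupling V \<mu>' \<nu>' (\<lambda>a b. t * \<pi> a b + (1 - t) * ?p a b)"
      unfolding coupling_def sum.distrib
    proof (intro conjI ballI)
      fix a b assume "a \<in> V" "b \<in> V"
      then show "0 \<le> t * \<pi> a b + (1 - t) * ?p a b"
        using \<pi> t by (auto simp: coupling_def)
    next
      fix a assume "a \<in> V"
      then show "(\<Sum>b\<in>V. t * \<pi> a b) + (\<Sum>b\<in>V. (1 - t) * ?p a b) = \<mu>' a"
        using \<pi> \<mu>' by (simp add: coupling_def rows flip: sum_distrib_left)
    next
      fix b assume "b \<in> V"
      then show "(\<Sum>a\<in>V. t * \<pi> a b) + (\<Sum>a\<in>V. (1 - t) * ?p a b) = \<nu>' b"
        using \<pi> \<nu>' by (simp add: coupling_def cols flip: sum_distrib_left)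
    qed
    then have "wasserstein1 V d \<mu>' \<nu>'
        \<le> (\<Sum>a\<in>V. \<Sum>b\<in>V. d a b * (t * \<pi> a b + (1 - t) * ?p a b))"
      using d by (rule wasserstein1_le_cost)
    also have "\<dots> = t * c + (1 - t) * (\<Sum>a\<in>V. \<Sum>b\<in>V. d a b * ?p a b)"
      unfolding c sum_distrib_left sum.distrib[symmetric]
      by (intro sum.cong refl) (simp only: algebra_simps)
    finally show "(wasserstein1 V d \<mu>' \<nu>' - (1 - t) * d x y) / t \<le> c"
      unfolding cost using t by (simp add: field_simps)
  qed
  then show ?thesis
    using t unfolding wasserstein1_def[of V d \<mu> \<nu>] by (simp add: field_simps)
qed

section \<open>Curvature of a weighted graph\<close>

text \<open>The diagonal is covered by the second branch, since a simple graph has no loops.\<close>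

definition step_prob :: "'a set set \<Rightarrow> ('a set \<Rightarrow> real) \<Rightarrow> 'a \<Rightarrow> 'a \<Rightarrow> real" where
  "step_prob E w x z = (if {x, z} \<in> E then w {x, z} / wdeg E w x else 0)"

text \<open>For the graph distance, the Lipschitz condition only has to be tested on edges: it adds up
  along a shortest walk.\<close>

lemma (in conn_graph) potential_diff_le_gdist:
  assumes g: "\<And>a b. {a, b} \<in> E \<Longrightarrow> g a - g b \<le> 1" and ab: "a \<in> V" "b \<in> V"
  shows "g a - g b \<le> real (gdist E a b)"
proof -
  have walk: "g a - g c \<le> real n" if "(a, c) \<in> adj_rel E ^^ n" for n c
    using that
  proof (induction n arbitrary: c)
    case (Suc n)
    then obtain u where "(a, u) \<in> adj_rel E ^^ n" "{u, c} \<in> E"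
      by (auto simp: adj_rel_def)
    then show ?case using Suc.IH[of u] g[of u c] by simp
  qed simp
  have "\<exists>n. (a, b) \<in> adj_rel E ^^ n"
    using connected ab by (auto simp: graph_connected_def rtrancl_power)
  then have "(a, b) \<in> adj_rel E ^^ gdist E a b"
    unfolding gdist_def by (rule LeastI_ex)
  then show ?thesis by (rule walk)
qed

lemma gdist_edge_le:
  assumes "{x, y} \<in> E"
  shows "gdist E x y \<le> 1"
  unfolding gdist_def by (rule Least_le) (use assms in \<open>simp add: adj_rel_def\<close>)

lemma gdist_self [simp]: "gdist E x x = 0"
  unfolding gdist_def by (rule Least_eq_0) simp

locale weighted_graph = conn_graph +
  fixes w :: "'a set \<Rightarrow> real"
  assumes positive: "positive_weight E w"
begin

abbreviation "p \<equiv> step_prob E w"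

lemma finite_nbrs: "finite {z. {x, z} \<in> E}"
  by (rule finite_subset[OF _ finite_V]) (auto dest: edgeD)

lemma wdeg_pos: "x \<in> V \<Longrightarrow> wdeg E w x > 0"
  unfolding wdeg_def using positive finite_nbrs
  by (intro sum_pos) (auto simp: positive_weight_def elim: no_isolated_vertex)

lemma p_pos: "{x, z} \<in> E \<Longrightarrow> p x z > 0"
  using positive wdeg_pos[of x] edgeD(1)[of x z] by (simp add: step_prob_def positive_weight_def)

lemma p_nonneg: "p x z \<ge> 0"
  using p_pos[of x z] by (cases "{x, z} \<in> E") (auto simp: step_prob_def)

lemma p_sum:
  assumes "x \<in> V"
  shows "(\<Sum>z\<in>V. p x z) = 1"
proof -
  have "(\<Sum>z\<in>V. p x z) = (\<Sum>z | {x, z} \<in> E. w {x, z} / wdeg E w x)"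
    by (rule sum.mono_neutral_cong_right) (auto simp: finite_V step_prob_def dest: edgeD)
  also have "\<dots> = 1"
    using wdeg_pos[OF assms] by (simp flip: sum_divide_distrib wdeg_def)
  finally show ?thesis .
qed

lemma walk_measure_eq:
  "walk_measure E w \<alpha> x z = \<alpha> * (if z = x then 1 else 0) + (1 - \<alpha>) * p x z"
  by (auto simp: walk_measure_def step_prob_def)

lemma sum_walk_measure:
  assumes "x \<in> V"
  shows "(\<Sum>z\<in>V. g z * walk_measure E w \<alpha> x z) = \<alpha> * g x + (1 - \<alpha>) * (\<Sum>z\<in>V. g z * p x z)"
proof -
  have "(\<Sum>z\<in>V. g z * walk_measure E w \<alpha> x z)
      = (\<Sum>z\<in>V. (if z = x then \<alpha> * g z else 0) + (1 - \<alpha>) * (g z * p x z))"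
    by (rule sum.cong) (auto simp: walk_measure_eq algebra_simps)
  then show ?thesis
    using assms finite_V by (simp add: sum.distrib sum_distrib_left)
qed

lemma walk_measure_coupling:
  assumes "x \<in> V" "y \<in> V" "0 \<le> \<alpha>" "\<alpha> \<le> 1"
  shows "coupling V (walk_measure E w \<alpha> x) (walk_measure E w \<alpha> y)
    (\<lambda>a b. walk_measure E w \<alpha> x a * walk_measure E w \<alpha> y b)"
proof -
  have sum1: "sum (walk_measure E w \<alpha> v) V = 1" if "v \<in> V" for v
    using sum_walk_measure[OF that, of "\<lambda>_. 1"] p_sum[OF that] by simp
  show ?thesis
    by (rule product_coupling) (use assms p_nonneg sum1 in \<open>auto simp: walk_measure_eq\<close>)
qed

text \<open>The walk of idleness \<open>\<beta>\<close> is the mixture, with weights \<open>t = (1 - \<beta>) / (1 - \<alpha>)\<close> and \<open>1 - t\<close>,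
  of the walk of idleness \<open>\<alpha>\<close> and the point mass at its start. Two such point masses at the
  ends of an edge are at distance at most \<open>1\<close>, so \<open>\<kappa>\<^sub>\<beta> \<ge> t \<kappa>\<^sub>\<alpha>\<close>.\<close>

lemma curv_ratio_mono:
  assumes e: "{x, y} \<in> E" and ab: "0 \<le> \<alpha>" "\<alpha> \<le> \<beta>" "\<beta> < 1"
  shows "curv_alpha V E w \<alpha> x y / (1 - \<alpha>) \<le> curv_alpha V E w \<beta> x y / (1 - \<beta>)"
proof -
  let ?d = "\<lambda>a b. real (gdist E a b)"
  let ?W = "\<lambda>\<alpha>. wasserstein1 V ?d (walk_measure E w \<alpha> x) (walk_measure E w \<alpha> y)"
  define t where "t = (1 - \<beta>) / (1 - \<alpha>)"
  have t: "0 < t" "t \<le> 1" using ab by (auto simp: t_def)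
  have xy: "x \<in> V" "y \<in> V" using edgeD[OF e] by auto
  have "t * (1 - \<alpha>) = 1 - \<beta>" using ab by (simp add: t_def)
  then have b: "\<beta> = t * \<alpha> + (1 - t)" by (simp add: algebra_simps)
  have "?W \<beta> \<le> t * ?W \<alpha> + (1 - t) * ?d x y"
    by (rule wasserstein1_mix_point_masses[OF finite_V xy t _ walk_measure_coupling])
      (use xy ab in \<open>auto simp: walk_measure_eq b algebra_simps\<close>)
  also have "\<dots> \<le> t * ?W \<alpha> + (1 - t)"
    using t gdist_edge_le[OF e] by (auto intro: mult_left_le)
  finally have "t * (1 - ?W \<alpha>) \<le> 1 - ?W \<beta>" by (simp add: algebra_simps)
  then show ?thesis
    unfolding curv_alpha_def t_def using ab by (simp add: field_simps)
qed

text \<open>The potential \<open>g\<close> drops by \<open>2\<close> only from \<open>x\<close> to a non-neighbour of \<open>x\<close>, never along an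
  edge. It vanishes on all neighbours of \<open>x\<close>, so the walk from \<open>x\<close> sees only its idle
  mass \<open>\<alpha>\<close>.\<close>

lemma curv_ratio_le:
  assumes e: "{x, y} \<in> E" and \<alpha>: "0 \<le> \<alpha>" "\<alpha> < 1"
  shows "curv_alpha V E w \<alpha> x y / (1 - \<alpha>)
    \<le> 1 + p y x - (\<Sum>z\<in>{z\<in>V. z \<noteq> x \<and> {x, z} \<notin> E}. p y z)"
proof -
  let ?Z = "{z\<in>V. z \<noteq> x \<and> {x, z} \<notin> E}"
  let ?W = "wasserstein1 V (\<lambda>a b. real (gdist E a b)) (walk_measure E w \<alpha> x) (walk_measure E w \<alpha> y)"
  define g :: "'a \<Rightarrow> real" where
    "g z = (if z = x then 1 else 0) - (if z \<in> ?Z then 1 else 0)" for z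
  have xy: "x \<in> V" "y \<in> V" "x \<noteq> y" using edgeD[OF e] by auto
  have dot: "(\<Sum>z\<in>V. g z * p v z) = p v x - (\<Sum>z\<in>?Z. p v z)" for v
  proof -
    have "(\<Sum>z\<in>V. g z * p v z)
        = (\<Sum>z\<in>V. (if z = x then p v z else 0) - (if z \<in> ?Z then p v z else 0))"
      by (rule sum.cong) (auto simp: g_def)
    also have "\<dots> = p v x - (\<Sum>z\<in>V. if z \<in> ?Z then p v z else 0)"
      using xy finite_V by (simp add: sum_subtractf)
    also have "(\<Sum>z\<in>V. if z \<in> ?Z then p v z else 0) = (\<Sum>z\<in>?Z. p v z)"
      using finite_V by (intro sum.mono_neutral_cong_right) auto
    finally show ?thesis .
  qed
  have "(\<Sum>z\<in>V. g z * p x z) = 0"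
    unfolding dot by (simp add: step_prob_def)
  then have "(\<Sum>z\<in>V. g z * walk_measure E w \<alpha> x z) = \<alpha>"
    unfolding sum_walk_measure[OF xy(1)] by (simp add: g_def)
  moreover have "g y = 0" using e xy by (auto simp: g_def)
  then have "(\<Sum>z\<in>V. g z * walk_measure E w \<alpha> y z) = (1 - \<alpha>) * (p y x - (\<Sum>z\<in>?Z. p y z))"
    unfolding sum_walk_measure[OF xy(2)] dot by simp
  moreover have "(\<Sum>z\<in>V. g z * walk_measure E w \<alpha> x z) - (\<Sum>z\<in>V. g z * walk_measure E w \<alpha> y z) \<le> ?W"
  proof (rule wasserstein1_ge_potential[OF _ walk_measure_coupling])
    show "g a - g b \<le> real (gdist E a b)" if "a \<in> V" "b \<in> V" for a b
      by (rule potential_diff_le_gdist[OF _ that]) (auto simp: g_def dest: edgeD)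
  qed (use xy \<alpha> in auto)
  ultimately have "1 - ?W \<le> (1 - \<alpha>) * (1 + p y x - (\<Sum>z\<in>?Z. p y z))"
    by (simp add: algebra_simps)
  then show ?thesis
    unfolding curv_alpha_def using \<alpha> by (simp add: divide_le_eq mult.commute)
qed

text \<open>A bounded increasing function converges from the left to its supremum. Without this, the
  operator \<open>Lim\<close> in the definition of the curvature would carry no information.\<close>

lemma lly_edge_eq_Sup:
  assumes e: "{x, y} \<in> E"
  shows "lly_edge V E w x y = (SUP \<alpha>\<in>{0..<1}. curv_alpha V E w \<alpha> x y / (1 - \<alpha>))"
proof -
  let ?r = "\<lambda>\<alpha>. curv_alpha V E w \<alpha> x y / (1 - \<alpha>)"
  have bdd: "bdd_above (?r ` {0..<1})"
    using curv_ratio_le[OF e] by (intro bdd_aboveI2) auto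
  have near: "eventually (\<lambda>\<beta>. \<alpha> < \<beta> \<and> \<beta> < 1) (at_left 1)" if "\<alpha> < 1" for \<alpha> :: real
    using that by (auto simp: eventually_at_left_real eventually_at_left_field)
  have "(?r \<longlongrightarrow> (SUP \<alpha>\<in>{0..<1}. ?r \<alpha>)) (at_left 1)"
  proof (rule increasing_tendsto)
    show "eventually (\<lambda>\<beta>. ?r \<beta> \<le> (SUP \<alpha>\<in>{0..<1}. ?r \<alpha>)) (at_left 1)"
      using near[OF zero_less_one] by eventually_elim (auto intro!: cSUP_upper[OF _ bdd])
  next
    fix c assume "c < (SUP \<alpha>\<in>{0..<1}. ?r \<alpha>)"
    then obtain \<alpha> where \<alpha>: "\<alpha> \<in> {0..<1}" "c < ?r \<alpha>"
      using bdd by (auto simp: less_cSUP_iff)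
    then have "\<alpha> < 1" by simp
    show "eventually (\<lambda>\<beta>. c < ?r \<beta>) (at_left 1)"
      using near[OF \<open>\<alpha> < 1\<close>] by eventually_elim
        (use \<alpha> curv_ratio_mono[OF e] in \<open>fastforce intro: less_le_trans\<close>)
  qed
  then show ?thesis
    unfolding lly_edge_def by (intro tendsto_Lim) auto
qed

lemma lly_edge_le:
  assumes "{x, y} \<in> E"
  shows "lly_edge V E w x y \<le> 1 + p y x - (\<Sum>z\<in>{z\<in>V. z \<noteq> x \<and> {x, z} \<notin> E}. p y z)"
  unfolding lly_edge_eq_Sup[OF assms]
  by (rule cSUP_least) (use curv_ratio_le[OF assms] in auto)

lemma curv_ratio_le_lly_edge:
  assumes "{x, y} \<in> E" "0 \<le> \<alpha>" "\<alpha> < 1"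
  shows "curv_alpha V E w \<alpha> x y / (1 - \<alpha>) \<le> lly_edge V E w x y"
  unfolding lly_edge_eq_Sup[OF assms(1)]
proof (rule cSUP_upper)
  show "bdd_above ((\<lambda>\<alpha>. curv_alpha V E w \<alpha> x y / (1 - \<alpha>)) ` {0..<1})"
    using curv_ratio_le[OF assms(1)] by (intro bdd_aboveI2) auto
qed (use assms in auto)

lemma lly_edge_le_step:
  assumes "{x, y} \<in> E"
  shows "lly_edge V E w x y \<le> 1 + p y x"
  using lly_edge_le[OF assms] sum_nonneg[of "{z\<in>V. z \<noteq> x \<and> {x, z} \<notin> E}" "p y"] p_nonneg
  by fastforce

lemma lly_edge_le_of_induced_path:
  assumes "{x, y} \<in> E" "{y, z} \<in> E" "x \<noteq> z" "{x, z} \<notin> E"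
  shows "lly_edge V E w x y \<le> 1 + p y x - p y z"
proof -
  have "p y z \<le> (\<Sum>z\<in>{z\<in>V. z \<noteq> x \<and> {x, z} \<notin> E}. p y z)"
    by (rule member_le_sum) (use assms edgeD p_nonneg finite_V in auto)
  then show ?thesis using lly_edge_le[OF assms(1)] by linarith
qed

section \<open>The universal bound and its rigidity\<close>

text \<open>The double count over a densest subgraph \<open>(W, F)\<close>. The excess \<open>h\<close> of \<open>p\<close> over \<open>1/mad\<close> on
  \<open>F\<close>, and over \<open>0\<close> elsewhere, is nonnegative and sums to
  \<open>card W - 2 card F / mad = 0\<close> over \<open>W \<times> V\<close>, so it vanishes there. As \<open>p\<close> is positive on
  edges, every edge at a vertex of \<open>W\<close> lies in \<open>F\<close>; hence \<open>W\<close> is closed under adjacency and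
  contains every vertex.\<close>

lemma step_prob_rigid:
  assumes lower: "\<And>x y. {x, y} \<in> E \<Longrightarrow> 1 / mad V E \<le> p x y" and e: "{x, y} \<in> E"
  shows "p x y = 1 / mad V E"
proof -
  let ?M = "mad V E"
  obtain W F where WF: "subgraph_of W F V E" "W \<noteq> {}" "?M * real (card W) = 2 * real (card F)"
    by (rule mad_attained)
  have sg: "simple_graph W F" "W \<subseteq> V" "F \<subseteq> E" using WF(1) by (auto simp: subgraph_of_def)
  have fin: "finite W" using sg finite_V finite_subset by blast
  define n where "n a = card {b\<in>W. {a, b} \<in> F}" for a
  define h where "h a b = p a b - (if {a, b} \<in> F then 1 / ?M else 0)" for a b
  have h: "h a b \<ge> 0" for a b
    using lower[of a b] p_nonneg sg by (auto simp: h_def)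
  have h_sum: "(\<Sum>b\<in>V. h a b) = 1 - real (n a) / ?M" if "a \<in> W" for a
  proof -
    have "(\<Sum>b\<in>V. if {a, b} \<in> F then 1 / ?M else 0) = (\<Sum>b\<in>{b\<in>W. {a, b} \<in> F}. 1 / ?M)"
      using sg by (intro sum.mono_neutral_cong_right) (auto simp: finite_V simple_graph_def)
    then show ?thesis using p_sum[of a] that sg by (auto simp: h_def sum_subtractf n_def)
  qed
  have "(\<Sum>a\<in>W. \<Sum>b\<in>V. h a b) = (\<Sum>a\<in>W. 1 - real (n a) / ?M)"
    using h_sum by simp
  also have "\<dots> = real (card W) - real (\<Sum>a\<in>W. n a) / ?M"
    by (simp add: sum_subtractf sum_divide_distrib)
  also have "\<dots> = 0"
    using handshake[OF sg(1)] WF(3) mad_pos by (simp add: n_def field_simps)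
  finally have "(\<Sum>b\<in>V. h a b) = 0" if "a \<in> W" for a
    using that h fin by (subst (asm) sum_nonneg_eq_0_iff) (auto intro: sum_nonneg)
  then have h0: "h a b = 0" if "a \<in> W" "b \<in> V" for a b
    using that h finite_V by (metis sum_nonneg_eq_0_iff)
  have inF: "{a, b} \<in> F" if "a \<in> W" "{a, b} \<in> E" for a b
    using h0[of a b] p_pos[of a b] edgeD[of a b] that by (auto simp: h_def split: if_splits)
  obtain u where "u \<in> W" using WF(2) by blast
  have "x \<in> W"
  proof (rule connected_induct[of u x])
    show "b \<in> W" if "a \<in> W" "{a, b} \<in> E" for a b
      using inF[OF that] sg by (auto simp: simple_graph_def)
  qed (use \<open>u \<in> W\<close> sg edgeD[OF e] in auto)
  then show ?thesis
    using inF[OF _ e] h0[of x y] edgeD[OF e] by (simp add: h_def)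
qed

lemma finite_lly_edges: "finite {lly_edge V E w x y | x y. {x, y} \<in> E}"
proof (rule finite_subset)
  show "{lly_edge V E w x y | x y. {x, y} \<in> E} \<subseteq> (\<lambda>(x, y). lly_edge V E w x y) ` (V \<times> V)"
    by (auto dest: edgeD)
qed (use finite_V in auto)

lemma lly_graph_le_edge: "{x, y} \<in> E \<Longrightarrow> lly_graph V E w \<le> lly_edge V E w x y"
  unfolding lly_graph_def by (rule Min_le[OF finite_lly_edges]) blast

lemma lly_graph_ge:
  assumes "\<And>x y. {x, y} \<in> E \<Longrightarrow> c \<le> lly_edge V E w x y"
  shows "c \<le> lly_graph V E w"
proof -
  have "{lly_edge V E w x y | x y. {x, y} \<in> E} \<noteq> {}" using some_edge by blast
  then show ?thesis
    unfolding lly_graph_def using finite_lly_edges assms by (subst Min_ge_iff) auto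
qed

lemma step_prob_eq_if_lly_graph_ge:
  assumes "1 + 1 / mad V E \<le> lly_graph V E w" and "{x, y} \<in> E"
  shows "p x y = 1 / mad V E"
proof (rule step_prob_rigid[OF _ assms(2)])
  fix x y assume e: "{x, y} \<in> E"
  show "1 / mad V E \<le> p x y"
    using assms(1) lly_graph_le_edge lly_edge_le_step[of y x] edgeD(4)[OF e] by fastforce
qed

text \<open>A minimum above the bound would make some \<open>p y x\<close> exceed \<open>1/mad\<close>, which rigidity
  excludes.\<close>

lemma lly_graph_le: "lly_graph V E w \<le> 1 + 1 / mad V E"
proof (rule ccontr)
  assume *: "\<not> ?thesis"
  obtain x y where e: "{x, y} \<in> E" by (rule some_edge)
  then have "p y x = 1 / mad V E"
    using * step_prob_eq_if_lly_graph_ge edgeD(4) by auto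
  then show False
    using * lly_graph_le_edge[OF e] lly_edge_le_step[OF e] by linarith
qed

lemma complete_if_lly_graph_eq:
  assumes eq: "lly_graph V E w = 1 + 1 / mad V E"
  shows "graph_complete V E"
proof (rule ccontr)
  assume "\<not> graph_complete V E"
  then obtain x y z where xyz: "{x, y} \<in> E" "{y, z} \<in> E" "x \<noteq> z" "{x, z} \<notin> E"
    by (rule induced_path_if_not_complete)
  have "1 + 1 / mad V E \<le> 1 + p y x - p y z"
    using lly_edge_le_of_induced_path[OF xyz] lly_graph_le_edge[OF xyz(1)] eq by linarith
  also have "\<dots> = 1"
    using eq xyz edgeD(4) by (simp add: step_prob_eq_if_lly_graph_ge)
  finally show False using mad_pos by (simp add: divide_le_0_iff)
qed

text \<open>The weight of an edge is the weighted degree of either end divided by \<open>mad\<close>, so weighted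
  degrees agree along edges and hence everywhere.\<close>

lemma weight_constant_if_lly_graph_eq:
  assumes eq: "lly_graph V E w = 1 + 1 / mad V E"
  shows "\<exists>c. \<forall>e\<in>E. w e = c"
proof -
  have w: "w {x, y} = wdeg E w x / mad V E" if "{x, y} \<in> E" for x y
    using step_prob_eq_if_lly_graph_ge[of x y] eq that wdeg_pos[of x] edgeD(1)[OF that] mad_pos
    by (simp add: step_prob_def field_simps)
  obtain u v where uv: "{u, v} \<in> E" by (rule some_edge)
  have deg: "wdeg E w x = wdeg E w u" if "x \<in> V" for x
  proof (rule connected_induct[of u x])
    show "wdeg E w b = wdeg E w u" if "wdeg E w a = wdeg E w u" "{a, b} \<in> E" for a b
      using w[of a b] w[of b a] that edgeD(4)[OF that(2)] mad_pos
      by (simp add: insert_commute)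
  qed (use that edgeD[OF uv] in auto)
  have "w e = wdeg E w u / mad V E" if "e \<in> E" for e
  proof -
    obtain x y where "e = {x, y}" using edge_pairE[OF \<open>e \<in> E\<close>] by blast
    then show ?thesis using that w[of x y] deg[of x] edgeD(1)[of x y] by simp
  qed
  then show ?thesis by blast
qed

end

section \<open>Complete graphs\<close>

context conn_graph
begin

lemma uniform_weight: "weighted_graph V E (\<lambda>_. 1)"
  by unfold_locales (simp add: positive_weight_def)

lemma lly_max_le: "lly_max V E \<le> 1 + 1 / mad V E"
  unfolding lly_max_def
proof (rule cSup_least)
  show "{lly_graph V E w | w. positive_weight E w} \<noteq> {}"
    using weighted_graph.positive[OF uniform_weight] by blast
qed (auto intro!: weighted_graph.lly_graph_le weighted_graph.intro weighted_graph_axioms.intro conn_graph_axioms)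

context
  assumes complete: "graph_complete V E"
begin

lemma complete_edge_iff: "{x, y} \<in> E \<longleftrightarrow> x \<in> V \<and> y \<in> V \<and> x \<noteq> y"
  using complete edgeD[of x y] by (auto simp: graph_complete_def)

lemma two_vertices: "card V \<ge> 2"
proof -
  obtain x y where e: "{x, y} \<in> E" by (rule some_edge)
  have "card {x, y} \<le> card V" by (rule card_mono) (use edgeD[OF e] finite_V in auto)
  then show ?thesis using edgeD(3)[OF e] by simp
qed

lemma complete_le_mad: "real (card V) - 1 \<le> mad V E"
proof -
  have "card {b\<in>V. {a, b} \<in> E} = card V - 1" if "a \<in> V" for a
  proof -
    have "{b\<in>V. {a, b} \<in> E} = V - {a}" using that by (auto simp: complete_edge_iff)
    then show ?thesis using that finite_V by simp
  qed
  then have "2 * card E = card V * (card V - 1)"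
    using handshake[OF simple] by simp
  then have "2 * real (card E) = real (card V) * (real (card V) - 1)"
    using two_vertices by (metis of_nat_1 of_nat_diff of_nat_mult of_nat_numeral one_le_numeral order_trans)
  then have "2 * real (card E) / real (card V) = real (card V) - 1"
    using card_V_pos by simp
  then show ?thesis using average_degree_le_mad by simp
qed

text \<open>At idleness \<open>1/n\<close> the walks from any two vertices have the same law, the uniform one, and
  the diagonal coupling has cost \<open>0\<close>.\<close>

lemma complete_uniform_lly_graph_ge:
  "1 + 1 / (real (card V) - 1) \<le> lly_graph V E (\<lambda>_. 1)"
proof -
  interpret weighted_graph V E "\<lambda>_. 1" by (rule uniform_weight)
  let ?n = "real (card V)"
  let ?\<mu> = "walk_measure E (\<lambda>_. 1) (1 / ?n)"
  have n: "?n \<ge> 2" using two_vertices by simp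
  have uniform: "?\<mu> x z = 1 / ?n" if "x \<in> V" "z \<in> V" for x z
  proof -
    have "{z. {x, z} \<in> E} = V - {x}" using that by (auto simp: complete_edge_iff)
    then have "wdeg E (\<lambda>_. 1) x = ?n - 1"
      using that finite_V two_vertices by (simp add: wdeg_def)
    moreover have "(1 - 1 / ?n) / (?n - 1) = 1 / ?n" using n by (simp add: field_simps)
    ultimately show ?thesis
      using that by (simp add: walk_measure_def complete_edge_iff)
  qed
  show ?thesis
  proof (rule lly_graph_ge)
    fix x y assume e: "{x, y} \<in> E"
    have "coupling V (?\<mu> x) (?\<mu> y) (\<lambda>a b. if a = b then 1 / ?n else 0)"
      using uniform edgeD[OF e] finite_V by (auto simp: coupling_def)
    from wasserstein1_le_cost[OF this, of "\<lambda>a b. real (gdist E a b)"]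
    have "wasserstein1 V (\<lambda>a b. real (gdist E a b)) (?\<mu> x) (?\<mu> y)
        \<le> (\<Sum>a\<in>V. \<Sum>b\<in>V. real (gdist E a b) * (if a = b then 1 / ?n else 0))"
      by simp
    also have "\<dots> = 0" by (intro sum.neutral ballI) auto
    finally have "1 \<le> curv_alpha V E (\<lambda>_. 1) (1 / ?n) x y" by (simp add: curv_alpha_def)
    then have "1 / (1 - 1 / ?n) \<le> curv_alpha V E (\<lambda>_. 1) (1 / ?n) x y / (1 - 1 / ?n)"
      using n by (intro divide_right_mono) auto
    also have "\<dots> \<le> lly_edge V E (\<lambda>_. 1) x y"
      using e n by (intro curv_ratio_le_lly_edge) auto
    also have "1 / (1 - 1 / ?n) = 1 + 1 / (?n - 1)" using n by (simp add: field_simps)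
    finally show "1 + 1 / (?n - 1) \<le> lly_edge V E (\<lambda>_. 1) x y" .
  qed
qed

text \<open>That no subgraph has larger average degree follows from the curvature bounds: the constant
  weight has curvature at least \<open>1 + 1/(n - 1)\<close>, and no weight exceeds \<open>1 + 1/mad\<close>.\<close>

lemma complete_mad: "mad V E = real (card V) - 1"
proof (rule antisym)
  have "1 / (real (card V) - 1) \<le> 1 / mad V E"
    using complete_uniform_lly_graph_ge weighted_graph.lly_graph_le[OF uniform_weight] by linarith
  then show "mad V E \<le> real (card V) - 1"
    using mad_pos two_vertices by (simp add: field_simps)
qed (rule complete_le_mad)

lemma complete_uniform_lly_graph: "lly_graph V E (\<lambda>_. 1) = 1 + 1 / mad V E"
  using complete_uniform_lly_graph_ge weighted_graph.lly_graph_le[OF uniform_weight]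
  by (simp add: complete_mad)

lemma complete_lly_max: "lly_max V E = 1 + 1 / mad V E"
proof (rule antisym[OF lly_max_le])
  have "lly_graph V E (\<lambda>_. 1) \<le> lly_max V E"
    unfolding lly_max_def
  proof (rule cSup_upper)
    show "lly_graph V E (\<lambda>_. 1) \<in> {lly_graph V E w | w. positive_weight E w}"
      using weighted_graph.positive[OF uniform_weight] by blast
    show "bdd_above {lly_graph V E w | w. positive_weight E w}"
      by (rule bdd_aboveI[of _ "1 + 1 / mad V E"])
        (auto intro!: weighted_graph.lly_graph_le weighted_graph.intro weighted_graph_axioms.intro
          conn_graph_axioms)
  qed
  then show "1 + 1 / mad V E \<le> lly_max V E" by (simp add: complete_uniform_lly_graph)
qed

end

end

theorem theorem5p1:
  fixes V :: "'a set" and E :: "'a set set"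
  assumes "simple_graph V E" and "graph_connected V E" and "E \<noteq> {}"
  shows "lly_max V E \<le> 1 + 1 / mad V E
    \<and> ((\<exists>w. positive_weight E w \<and> lly_graph V E w = 1 + 1 / mad V E) \<longleftrightarrow> graph_complete V E)
    \<and> (\<forall>n::nat. n \<ge> 2 \<and> card V = n \<and> graph_complete V E \<longrightarrow>
          lly_max V E = real n / (real n - 1)
          \<and> (\<forall>w. maximizing_weight V E w \<longrightarrow> (\<exists>c. \<forall>e\<in>E. w e = c)))"
proof -
  interpret conn_graph V E using assms by unfold_locales
  have weighted: "weighted_graph V E w" if "positive_weight E w" for w
    using that by unfold_locales
  have "(\<exists>w. positive_weight E w \<and> lly_graph V E w = 1 + 1 / mad V E) \<longleftrightarrow> graph_complete V E"
    using weighted_graph.complete_if_lly_graph_eq[OF weighted] complete_uniform_lly_graph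
      weighted_graph.positive[OF uniform_weight] by blast
  moreover have "lly_max V E = real n / (real n - 1)"
    if "n \<ge> 2" "card V = n" "graph_complete V E" for n
    using that complete_lly_max complete_mad by (simp add: field_simps)
  moreover have "\<exists>c. \<forall>e\<in>E. w e = c" if "graph_complete V E" "maximizing_weight V E w" for w
    using that weighted_graph.weight_constant_if_lly_graph_eq[OF weighted] complete_lly_max
    by (auto simp: maximizing_weight_def)
  ultimately show ?thesis using lly_max_le by blast
qed

end
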